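(* For all integers $m \geq 2$ and $k\ge 1$, \[ p_{OL}(k, m) \leq m^{3}(k+1)\left(\frac{m}{m-1}\right)^k. \]
   Context: Online panchromatic coloring: for positive integers $k,m,n$, consider the following game between Presenter and Colorer, who build a vertex-colored hypergraph $\mathcal H$ with $n$ (labeled) hyperedges one vertex at a time; initially there are no vertices and each hyperedge is empty. The players alternate. On Presenter's turn, Presenter introduces a new vertex $v$ and specifies the (nonempty) set of hyperedges to which $v$ belongs; Presenter may not add $v$ to a hyperedge already containing $k$ vertices. On Colorer's turn, Colorer gives $v$ one of $m$ colors. The game ends when each of the $n$ hyperedges contains exactly $k$ vertices. Presenter wins if at the end some hyperedge contains vertices of fewer than $m$ different colors; Colorer wins if every hyperedge contains a vertex of each of the $m$ colors (i.e. the coloring is panchromatic). $p_{OL}(k,m)$ denotes the minimum $n$ such that Presenter has a winning strategy in this game with $k$-vertex hyperedges, $m$ colors and $n$ hyperedges. *)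

theory Defs
  imports Complex_Main "HOL-Library.Extended_Nat" "HOL-Library.Extended_Real"
begin

text \<open>
  The hyperedges are labeled \<open>0, ..., n - 1\<close> and the colors are \<open>0, ..., m - 1\<close>.
  A position (with Presenter to move) is the list of the vertices introduced so far, in order.
  Vertex \<open>i\<close> is the \<open>i\<close>-th entry \<open>(S, c)\<close>, where \<open>S\<close> is the set of hyperedges containing it
  and \<open>c\<close> is its color.
\<close>

type_synonym position = "(nat set \<times> nat) list"

definition edge_vertices :: "position \<Rightarrow> nat \<Rightarrow> nat set" where
  "edge_vertices h e = {i. i < length h \<and> e \<in> fst (h ! i)}"

definition edge_colors :: "position \<Rightarrow> nat \<Rightarrow> nat set" where
  "edge_colors h e = (\<lambda>i. snd (h ! i)) ` edge_vertices h e"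

definition legal_presentation :: "nat \<Rightarrow> nat \<Rightarrow> position \<Rightarrow> nat set \<Rightarrow> bool" where
  "legal_presentation k n h S \<longleftrightarrow>
     S \<noteq> {} \<and> S \<subseteq> {..<n} \<and> (\<forall>e\<in>S. card (edge_vertices h e) < k)"

definition game_over :: "nat \<Rightarrow> nat \<Rightarrow> position \<Rightarrow> bool" where
  "game_over k n h \<longleftrightarrow> (\<forall>e<n. card (edge_vertices h e) = k)"

definition presenter_wins_at :: "nat \<Rightarrow> nat \<Rightarrow> position \<Rightarrow> bool" where
  "presenter_wins_at m n h \<longleftrightarrow> (\<exists>e<n. card (edge_colors h e) < m)"

text \<open>
  The positions that can arise when Presenter follows the strategy \<open>\<sigma>\<close>
  and Colorer plays arbitrarily.
\<close>

inductive reachable :: "nat \<Rightarrow> nat \<Rightarrow> nat \<Rightarrow> (position \<Rightarrow> nat set) \<Rightarrow> position \<Rightarrow> bool"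
  for k m n :: nat and \<sigma> :: "position \<Rightarrow> nat set" where
  start: "reachable k m n \<sigma> []"
| step: "reachable k m n \<sigma> h \<Longrightarrow> \<not> game_over k n h \<Longrightarrow> c < m \<Longrightarrow>
           reachable k m n \<sigma> (h @ [(\<sigma> h, c)])"

text \<open>
  No clause about infinite plays is needed: a legal presentation adds a vertex to at least one
  hyperedge that is not full, so every play ends after at most \<open>n * k\<close> rounds.
\<close>

definition presenter_winning_strategy ::
  "nat \<Rightarrow> nat \<Rightarrow> nat \<Rightarrow> (position \<Rightarrow> nat set) \<Rightarrow> bool" where
  "presenter_winning_strategy k m n \<sigma> \<longleftrightarrow>
     (\<forall>h. reachable k m n \<sigma> h \<longrightarrow>
        (\<not> game_over k n h \<longrightarrow> legal_presentation k n h (\<sigma> h)) \<and>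
        (game_over k n h \<longrightarrow> presenter_wins_at m n h))"

text \<open>
  The value is in \<^typ>\<open>enat\<close>, with \<open>\<infinity>\<close> if Presenter cannot win for any number of hyperedges,
  so that a finite upper bound includes the existence of a suitable \<open>n\<close>.
\<close>

definition p_OL :: "nat \<Rightarrow> nat \<Rightarrow> enat" where
  "p_OL k m = Inf {enat n | n. n \<ge> 1 \<and> (\<exists>\<sigma>. presenter_winning_strategy k m n \<sigma>)}"

end

theory Submission
  imports Defs "HOL-Library.Disjoint_Sets"
begin

text \<open>
  Call the number of vertices of a hyperedge its level, and designate for every nonempty hyperedge
  a color that it should avoid; a hyperedge dies when it receives its designated color. Let
  \<open>A\<^sub>k\<^sub>-\<^sub>1 = 1\<close> and \<open>A\<^sub>i\<^sub>-\<^sub>1 = \<lceil>A\<^sub>i m / (m - 1)\<rceil>\<close>, and give a live hyperedge of level \<open>i\<close> the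
  weight \<open>1 / A\<^sub>i\<close>. In each round Presenter puts the new vertex, for every color \<open>j\<close>, into a chunk of
  exactly \<open>A\<^sub>i\<close> live hyperedges of level \<open>i\<close> designated \<open>j\<close>, where \<open>i\<close> is the highest level that
  contains so many; if there is none, into \<open>A\<^sub>0\<close> empty hyperedges. Every chunk has weight 1.
  Colorer's answer kills one chunk, and each of the other \<open>m - 1\<close> chunks gains at least
  \<open>1 / (m - 1)\<close>, so the total weight never decreases. A level receives hyperedges of a given
  designation only while it holds less than a chunk of them, so the nonempty live hyperedges have
  bounded weight and Presenter never runs out of empty ones. The only way out for the play is
  that a live hyperedge becomes full.
\<close>

section \<open>Presenter strategies from invariants\<close>

abbreviation level :: "position \<Rightarrow> nat \<Rightarrow> nat" where
  "level h e \<equiv> card (edge_vertices h e)"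

lemma edge_vertices_snoc:
  "edge_vertices (h @ [(S, c)]) e =
     (if e \<in> S then insert (length h) (edge_vertices h e) else edge_vertices h e)"
  by (auto simp: edge_vertices_def nth_append less_Suc_eq)

lemma finite_edge_vertices: "finite (edge_vertices h e)"
  by (simp add: edge_vertices_def)

lemma level_Nil [simp]: "level [] e = 0"
  by (simp add: edge_vertices_def)

lemma level_snoc [simp]:
  "level (h @ [(S, c)]) e = (if e \<in> S then Suc (level h e) else level h e)"
proof -
  have "length h \<notin> edge_vertices h e"
    by (simp add: edge_vertices_def)
  then show ?thesis
    by (simp add: edge_vertices_snoc finite_edge_vertices)
qed

lemma edge_colors_Nil [simp]: "edge_colors [] e = {}"
  by (simp add: edge_colors_def edge_vertices_def)

lemma edge_colors_snoc [simp]: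
  "edge_colors (h @ [(S, c)]) e =
     (if e \<in> S then insert c (edge_colors h e) else edge_colors h e)"
proof -
  have "(\<lambda>i. snd ((h @ [(S, c)]) ! i)) ` edge_vertices h e = edge_colors h e"
    unfolding edge_colors_def by (rule image_cong) (auto simp: edge_vertices_def nth_append)
  then show ?thesis
    by (auto simp: edge_colors_def [of "h @ _"] edge_vertices_snoc)
qed

lemma edge_colors_empty: "level h e = 0 \<Longrightarrow> edge_colors h e = {}"
  by (simp add: edge_colors_def finite_edge_vertices)

text \<open>A strategy sees the whole position, so moves preserving \<open>Q\<close> can be picked
  position by position; induction over reachable positions does the rest.\<close>

lemma presenter_winning_strategy_of_invariant:
  assumes "Q []"
    and over: "\<And>h. Q h \<Longrightarrow> game_over k n h \<Longrightarrow> presenter_wins_at m n h"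
    and step: "\<And>h. Q h \<Longrightarrow> \<not> game_over k n h \<Longrightarrow>
                 \<exists>S. legal_presentation k n h S \<and> (\<forall>c<m. Q (h @ [(S, c)]))"
  shows "\<exists>\<sigma>. presenter_winning_strategy k m n \<sigma>"
proof -
  have "\<exists>\<sigma>. \<forall>h. Q h \<longrightarrow> \<not> game_over k n h \<longrightarrow>
          legal_presentation k n h (\<sigma> h) \<and> (\<forall>c<m. Q (h @ [(\<sigma> h, c)]))"
    using step by (intro choice) blast
  then obtain \<sigma> where \<sigma>: "\<And>h. Q h \<Longrightarrow> \<not> game_over k n h \<Longrightarrow>
          legal_presentation k n h (\<sigma> h) \<and> (\<forall>c<m. Q (h @ [(\<sigma> h, c)]))"
    by blast
  have "Q h" if "reachable k m n \<sigma> h" for h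
    using that by induction (use \<open>Q []\<close> \<sigma> in auto)
  with \<sigma> over show ?thesis
    unfolding presenter_winning_strategy_def by blast
qed

section \<open>Chunk sizes\<close>

text \<open>The index counts levels down from \<open>k - 1\<close>. The recursion is the ceiling of
  \<open>chunk m r * m / (m - 1)\<close> with its integer part split off; adding
  \<open>m - 2\<close> rounds the quotient up.\<close>

fun chunk :: "nat \<Rightarrow> nat \<Rightarrow> nat" where
  "chunk m 0 = 1"
| "chunk m (Suc r) = chunk m r + (chunk m r + (m - 2)) div (m - 1)"

lemma chunk_pos [simp]: "chunk m r > 0"
  by (induction r) auto

lemma chunk_neq_0 [simp]: "chunk m r \<noteq> 0"
  using chunk_pos [of m r] by simp

text \<open>Rounding up keeps the growth factor at least \<open>m / (m - 1)\<close>; this is the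
  source of the gain \<open>1 / (m - 1)\<close> of a surviving chunk.\<close>

lemma chunk_Suc_ge:
  assumes "m \<ge> 2"
  shows "1 + 1 / (real m - 1) \<le> real (chunk m (Suc r)) / real (chunk m r)"
proof -
  define q where "q = (chunk m r + (m - 2)) div (m - 1)"
  have "chunk m r \<le> (m - 1) * q"
  proof -
    have "chunk m r + (m - 2) = (m - 1) * q + (chunk m r + (m - 2)) mod (m - 1)"
      by (simp only: q_def mult_div_mod_eq)
    moreover have "(chunk m r + (m - 2)) mod (m - 1) < m - 1"
      using assms by (intro mod_less_divisor) simp
    ultimately show ?thesis
      using assms by linarith
  qed
  then have "real (chunk m r) \<le> (real m - 1) * real q"
    using assms by (metis (no_types) of_nat_le_iff of_nat_mult of_nat_diff of_nat_1
        one_le_numeral order_trans)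
  then have "1 / (real m - 1) \<le> real q / real (chunk m r)"
    using assms by (simp add: field_simps)
  then show ?thesis
    by (simp add: q_def add_divide_distrib)
qed

text \<open>The rounded quotient is at most \<open>chunk m r\<close> because the divisor is at least
  1.\<close>

lemma chunk_Suc_le:
  assumes "m \<ge> 2"
  shows "chunk m (Suc r) \<le> 2 * chunk m r"
proof -
  have "(chunk m r + (m - 2)) div (m - 1) < chunk m r + 1"
  proof (rule less_mult_imp_div_less)
    have "m - 2 < m - 1" and "chunk m r \<le> chunk m r * (m - 1)"
      using assms by auto
    then show "chunk m r + (m - 2) < (chunk m r + 1) * (m - 1)"
      unfolding add_mult_distrib by linarith
  qed
  then show ?thesis
    by simp
qed

lemma chunk_upper:
  assumes "m \<ge> 2"
  shows "real (chunk m r) \<le> (real m - 1) * (real m / (real m - 1)) ^ r"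
proof -
  \<comment> \<open>The shift by \<open>m - 2\<close> absorbs the rounding error of the ceiling.\<close>
  have "real (chunk m r) + (real m - 2) \<le> (real m - 1) * (real m / (real m - 1)) ^ r"
  proof (induction r)
    case 0
    then show ?case by simp
  next
    case (Suc r)
    define b where "b = real (chunk m r)"
    have "real ((chunk m r + (m - 2)) div (m - 1)) \<le> (b + (real m - 2)) / (real m - 1)"
      using of_nat_div_le_of_nat [of "chunk m r + (m - 2)" "m - 1", where 'a = real] assms
      by (simp add: of_nat_diff b_def add_diff_eq)
    then have "real (chunk m (Suc r)) + (real m - 2) \<le>
        (b + (real m - 2)) + (b + (real m - 2)) / (real m - 1)"
      by (simp add: b_def)
    also have "\<dots> = (b + (real m - 2)) * (real m / (real m - 1))"
      using assms by (simp add: field_simps)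
    also have "\<dots> \<le> (real m - 1) * (real m / (real m - 1)) ^ r * (real m / (real m - 1))"
      using Suc assms unfolding b_def by (intro mult_right_mono) auto
    finally show ?case
      by (simp add: mult_ac)
  qed
  with assms show ?thesis
    by simp
qed

section \<open>The strategy\<close>

locale chunk_strategy =
  fixes k m n :: nat
  assumes m: "m \<ge> 2" and k: "k \<ge> 1"
begin

abbreviation A :: "nat \<Rightarrow> nat" where
  "A i \<equiv> chunk m (k - 1 - i)"

definition live :: "position \<Rightarrow> (nat \<Rightarrow> nat) \<Rightarrow> nat \<Rightarrow> nat \<Rightarrow> nat set" where
  "live h d j i = {e. e < n \<and> d e = j \<and> level h e = i \<and> j \<notin> edge_colors h e}"

definition empties :: "position \<Rightarrow> nat set" where
  "empties h = {e. e < n \<and> level h e = 0}"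

definition weight :: "position \<Rightarrow> (nat \<Rightarrow> nat) \<Rightarrow> nat \<Rightarrow> real" where
  "weight h d j = (\<Sum>i = 1..<k. real (card (live h d j i)) / real (A i))"

text \<open>A level receives a chunk from below only while it holds fewer than \<open>A i\<close>
  hyperedges, hence the slack \<open>A (i - 1)\<close>. The second conjunct compares the initial
  total weight with the current one, an empty hyperedge weighing \<open>1 / A 0\<close>.\<close>

definition rich :: "position \<Rightarrow> (nat \<Rightarrow> nat) \<Rightarrow> bool" where
  "rich h d \<longleftrightarrow>
     (\<forall>j<m. \<forall>i. 1 \<le> i \<longrightarrow> i < k \<longrightarrow> card (live h d j i) < A i + A (i - 1)) \<and>
     real n / real (A 0) \<le> (\<Sum>j<m. weight h d j) + real (card (empties h)) / real (A 0)"

definition won :: "position \<Rightarrow> bool" where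
  "won h \<longleftrightarrow> (\<exists>e<n. level h e = k \<and> card (edge_colors h e) < m)"

text \<open>The designation is quantified because a position does not record it. The bound on the
  colors turns one missing color into fewer than \<open>m\<close> colors.\<close>

definition safe :: "position \<Rightarrow> bool" where
  "safe h \<longleftrightarrow> (\<forall>e<n. level h e \<le> k \<and> edge_colors h e \<subseteq> {..<m}) \<and> (won h \<or> (\<exists>d. rich h d))"

lemma finite_live [simp]: "finite (live h d j i)"
  by (rule finite_subset [of _ "{..<n}"]) (auto simp: live_def)

lemma finite_empties [simp]: "finite (empties h)"
  by (simp add: empties_def)

section \<open>Bounded weight and the supply of empty hyperedges\<close>

lemma A_pred_le: "1 \<le> i \<Longrightarrow> i < k \<Longrightarrow> A (i - 1) \<le> 2 * A i"
  using chunk_Suc_le [OF m, of "k - 1 - i"] Suc_diff_le [of i "k - 1"]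
  by (simp del: chunk.simps add: Suc_diff_Suc)

lemma A_ratio: "Suc i < k \<Longrightarrow> 1 + 1 / (real m - 1) \<le> real (A i) / real (A (Suc i))"
  using chunk_Suc_ge [OF m, of "k - 1 - Suc i"] by (simp add: Suc_diff_Suc del: chunk.simps)

text \<open>Each of the \<open>k - 1\<close> weighted levels contributes at most 3, since
  \<open>A (i - 1) \<le> 2 * A i\<close>.\<close>

lemma weight_le:
  assumes "rich h d" and "j < m"
  shows "weight h d j \<le> 3 * (real k - 1)"
proof -
  have "weight h d j \<le> (\<Sum>i = 1..<k. 3)"
    unfolding weight_def
  proof (rule sum_mono)
    fix i assume i: "i \<in> {1..<k}"
    with assms have "card (live h d j i) < A i + A (i - 1)"
      by (simp add: rich_def)
    with A_pred_le [of i] i have "card (live h d j i) \<le> 3 * A i"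
      by simp
    then show "real (card (live h d j i)) / real (A i) \<le> 3"
      by (simp add: divide_le_eq)
  qed
  with k show ?thesis
    by (simp add: of_nat_diff)
qed

text \<open>The choice of \<open>n\<close> makes the total weight at least
  \<open>m * (3 * k - 2)\<close>. Nonempty live hyperedges account for at most
  \<open>m * 3 * (k - 1)\<close>, which leaves \<open>m\<close>: one chunk of empty hyperedges for
  every color.\<close>

lemma enough_empties:
  assumes "rich h d" and n: "n = A 0 * (m * (3 * k - 2))"
  shows "m * A 0 \<le> card (empties h)"
proof -
  have "(\<Sum>j<m. weight h d j) \<le> (\<Sum>j<m. 3 * (real k - 1))"
    using assms(1) by (intro sum_mono weight_le) auto
  moreover have "real n / real (A 0) = real m * (3 * real k - 2)"
    using k by (simp add: n of_nat_diff)
  ultimately have "real m \<le> real (card (empties h)) / real (A 0)"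
    using assms(1) by (simp add: rich_def algebra_simps)
  then have "real (m * A 0) \<le> real (card (empties h))"
    by (simp add: le_divide_eq)
  then show ?thesis
    by (simp only: of_nat_le_iff)
qed

section \<open>Selecting one chunk per color\<close>

definition top_chunks ::
  "position \<Rightarrow> (nat \<Rightarrow> nat) \<Rightarrow> (nat \<Rightarrow> nat) \<Rightarrow> (nat \<Rightarrow> nat set) \<Rightarrow> bool" where
  "top_chunks h d l K \<longleftrightarrow> disjoint_family_on K {..<m} \<and>
     (\<forall>j<m. l j < k \<and> card (K j) = A (l j) \<and>
        K j \<subseteq> (if l j = 0 then empties h else live h d j (l j)) \<and>
        (\<forall>i. l j < i \<longrightarrow> i < k \<longrightarrow> card (live h d j i) < A i))"

text \<open>In the worst case every color falls back on empty hyperedges; these are enumerated by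
  \<open>f\<close> and cut into consecutive blocks of length \<open>A 0\<close>.\<close>

lemma ex_top_chunks:
  assumes "m * A 0 \<le> card (empties h)"
  shows "\<exists>l K. top_chunks h d l K"
proof -
  obtain f where f: "bij_betw f {..<card (empties h)} (empties h)"
    using ex_bij_betw_nat_finite [of "empties h"] by (auto simp: atLeast0LessThan)
  define full where "full j = {i. 1 \<le> i \<and> i < k \<and> A i \<le> card (live h d j i)}" for j
  \<comment> \<open>Inserting 0 makes the empty hyperedges the fallback when no level holds a whole
    chunk.\<close>
  define l where "l j = Max (insert 0 (full j))" for j
  have fin: "finite (full j)" for j
    by (simp add: full_def)
  have l_cases: "l j = 0 \<or> l j \<in> full j" for j
    using Max_in [of "insert 0 (full j)"] fin [of j] by (auto simp: l_def)
  have l_top: "i \<le> l j" if "i \<in> full j" for i j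
    using that fin [of j] by (simp add: l_def)
  have "\<forall>j. \<exists>X. l j \<noteq> 0 \<longrightarrow> X \<subseteq> live h d j (l j) \<and> card X = A (l j)"
  proof
    fix j
    show "\<exists>X. l j \<noteq> 0 \<longrightarrow> X \<subseteq> live h d j (l j) \<and> card X = A (l j)"
    proof (cases "l j = 0")
      case False
      with l_cases [of j] have "A (l j) \<le> card (live h d j (l j))"
        by (auto simp: full_def)
      then show ?thesis
        by (meson obtain_subset_with_card_n)
    qed simp
  qed
  then obtain X where X: "\<And>j. l j \<noteq> 0 \<Longrightarrow> X j \<subseteq> live h d j (l j) \<and> card (X j) = A (l j)"
    by metis
  define I where "I j = {j * A 0..<(j + 1) * A 0}" for j
  define K where "K j = (if l j = 0 then f ` I j else X j)" for j
  have I_sub: "I j \<subseteq> {..<card (empties h)}" if "j < m" for j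
  proof -
    have "(j + 1) * A 0 \<le> m * A 0"
      using that by (intro mult_right_mono) auto
    with assms show ?thesis
      by (auto simp: I_def)
  qed
  have I_disj: "I j \<inter> I j' = {}" if "j < j'" for j j'
  proof -
    have "(j + 1) * A 0 \<le> j' * A 0"
      using that by (intro mult_right_mono) auto
    then show ?thesis
      by (auto simp: I_def)
  qed
  have K_sub: "K j \<subseteq> (if l j = 0 then empties h else live h d j (l j))" if "j < m" for j
    using X [of j] I_sub [OF that] f by (auto simp: K_def bij_betw_def)
  have K_elem: "level h e = l j \<and> (l j = 0 \<or> d e = j)" if "j < m" "e \<in> K j" for j e
    using K_sub [OF that(1)] that(2)
    by (cases "l j = 0") (auto simp: empties_def live_def)
  have "disjoint_family_on K {..<m}"
    unfolding disjoint_family_on_def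
  proof (intro ballI impI)
    fix i j assume ij: "i \<in> {..<m}" "j \<in> {..<m}" "i \<noteq> j"
    show "K i \<inter> K j = {}"
    proof (cases "l i = 0 \<and> l j = 0")
      case True
      have "I i \<inter> I j = {}"
        using I_disj [of i j] I_disj [of j i] ij by (cases i j rule: linorder_cases) auto
      moreover have "inj_on f (I i \<union> I j)"
        using f I_sub [of i] I_sub [of j] ij by (auto simp: bij_betw_def intro: inj_on_subset)
      ultimately show ?thesis
        using True by (simp add: K_def inj_on_Un_image_eq_iff)
          (metis inj_on_image_Int Un_upper1 Un_upper2 image_empty)
    next
      \<comment> \<open>A common element would give both chunks the same, hence positive, level, and
        its designation would be both \<open>i\<close> and \<open>j\<close>.\<close>
      case False
      with K_elem ij show ?thesis
        by (metis IntE equals0I lessThan_iff)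
    qed
  qed
  moreover have "card (K j) = A (l j)" if "j < m" for j
  proof (cases "l j = 0")
    case True
    have "inj_on f (I j)"
      using f I_sub [OF that] by (auto simp: bij_betw_def intro: inj_on_subset)
    with True show ?thesis
      by (simp add: K_def card_image I_def)
  qed (use X in \<open>auto simp: K_def\<close>)
  moreover have "card (live h d j i) < A i" if "l j < i" "i < k" for i j
    using l_top [of i j] that by (force simp: full_def)
  moreover have "l j < k" for j
    using l_cases [of j] k by (auto simp: full_def)
  ultimately have "top_chunks h d l K"
    using K_sub by (simp add: top_chunks_def)
  then show ?thesis
    by blast
qed

section \<open>Effect of one round\<close>

definition redesignate :: "(nat \<Rightarrow> nat set) \<Rightarrow> (nat \<Rightarrow> nat) \<Rightarrow> nat \<Rightarrow> nat" where
  "redesignate K d e = (if \<exists>j<m. e \<in> K j then THE j. j < m \<and> e \<in> K j else d e)"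

context
  fixes h d l K
  assumes top: "top_chunks h d l K"
begin

lemma
  assumes "j < m"
  shows level_bound: "l j < k"
    and card_chunk: "card (K j) = A (l j)"
    and chunk_subset: "K j \<subseteq> (if l j = 0 then empties h else live h d j (l j))"
    and above_top: "l j < i \<Longrightarrow> i < k \<Longrightarrow> card (live h d j i) < A i"
  using top assms by (simp_all add: top_chunks_def)

lemma chunk_elem: "j < m \<Longrightarrow> e \<in> K j \<Longrightarrow>
    e < n \<and> level h e = l j \<and> j \<notin> edge_colors h e \<and> (l j \<noteq> 0 \<longrightarrow> d e = j)"
  using chunk_subset [of j] edge_colors_empty [of h e]
  by (cases "l j = 0") (auto simp: empties_def live_def)

lemma chunk_unique: "i < m \<Longrightarrow> j < m \<Longrightarrow> e \<in> K i \<Longrightarrow> e \<in> K j \<Longrightarrow> i = j"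
  using top by (auto simp: top_chunks_def disjoint_family_on_def)

lemma finite_chunk: "j < m \<Longrightarrow> finite (K j)"
  using card_chunk [of j] by (metis card.infinite chunk_pos less_numeral_extra(3))

text \<open>Disjointness of the chunks makes the description unique. Chunks from a positive level
  were designated \<open>j\<close> already, so only empty hyperedges can change designation.\<close>

lemma redesignate_chunk: "j < m \<Longrightarrow> e \<in> K j \<Longrightarrow> redesignate K d e = j"
  unfolding redesignate_def using chunk_unique by (auto intro!: the_equality)

lemma redesignate_other: "e \<notin> (\<Union>j<m. K j) \<Longrightarrow> redesignate K d e = d e"
  by (auto simp: redesignate_def)

text \<open>A chunk leaves its level whatever the answer: it dies if \<open>j = c\<close> and
  otherwise rises by one level.\<close>

lemma live_step:
  assumes "j < m" and "1 \<le> i"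
  shows "live (h @ [(\<Union>j<m. K j, c)]) (redesignate K d) j i =
    (live h d j i - K j) \<union> (if j \<noteq> c \<and> i = Suc (l j) then K j else {})"
    (is "?L = ?R")
proof (rule set_eqI)
  fix e
  show "e \<in> ?L \<longleftrightarrow> e \<in> ?R"
  proof (cases "e \<in> (\<Union>j<m. K j)")
    case True
    then obtain j' where j': "j' < m" "e \<in> K j'"
      by auto
    note e = chunk_elem [OF j'] redesignate_chunk [OF j'] chunk_unique [OF j'(1) assms(1) j'(2)]
    show ?thesis
    proof (cases "j' = j")
      case True
      with e j' True \<open>e \<in> (\<Union>j<m. K j)\<close> show ?thesis
        by (auto simp: live_def)
    next
      \<comment> \<open>A hyperedge of another chunk may have been designated \<open>j\<close>
        before, but only while empty; \<open>1 \<le> i\<close> excludes that level.\<close>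
      case False
      with e j' \<open>1 \<le> i\<close> \<open>e \<in> (\<Union>j<m. K j)\<close> show ?thesis
        by (auto simp: live_def)
    qed
  next
    case False
    with assms redesignate_other [OF False] show ?thesis
      by (auto simp: live_def)
  qed
qed

lemma card_live_step:
  assumes "j < m" and "1 \<le> i" and "i < k"
  shows "real (card (live (h @ [(\<Union>j<m. K j, c)]) (redesignate K d) j i)) =
    real (card (live h d j i)) - (if i = l j then real (A i) else 0)
      + (if i = Suc (l j) then if j \<noteq> c then real (A (l j)) else 0 else 0)"
proof (cases "i = l j")
  case True
  have sub: "K j \<subseteq> live h d j i"
    using chunk_subset [OF assms(1)] True assms(2) by simp
  then have "A i \<le> card (live h d j i)"
    using card_chunk [OF assms(1)] card_mono [OF finite_live sub] True by simp
  moreover have "live (h @ [(\<Union>j<m. K j, c)]) (redesignate K d) j i = live h d j i - K j"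
    using live_step [OF assms(1,2), of c] True by simp
  then have "card (live (h @ [(\<Union>j<m. K j, c)]) (redesignate K d) j i) =
      card (live h d j i) - A i"
    using card_chunk [OF assms(1)] finite_chunk [OF assms(1)] sub True
    by (simp add: card_Diff_subset)
  ultimately show ?thesis
    using True by (simp add: of_nat_diff)
next
  case False
  then have disj: "live h d j i \<inter> K j = {}"
    using chunk_elem [OF assms(1)] by (auto simp: live_def)
  then have "live h d j i - K j = live h d j i"
    by auto
  with False disj show ?thesis
    using card_chunk [OF assms(1)] finite_chunk [OF assms(1)]
    by (auto simp: live_step [OF assms(1,2)] card_Un_disjoint)
qed

text \<open>A chunk weighs 1 at its own level, so its departure costs 1 unless it comes from the
  empty hyperedges, which \<open>weight\<close> does not count. Level \<open>k\<close> carries no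
  weight, hence the test \<open>Suc (l j) < k\<close>.\<close>

lemma weight_step:
  assumes "j < m"
  shows "weight (h @ [(\<Union>j<m. K j, c)]) (redesignate K d) j = weight h d j
    - (if l j = 0 then 0 else 1)
    + (if j \<noteq> c \<and> Suc (l j) < k then real (A (l j)) / real (A (Suc (l j))) else 0)"
proof -
  have "weight (h @ [(\<Union>j<m. K j, c)]) (redesignate K d) j =
    (\<Sum>i = 1..<k. real (card (live h d j i)) / real (A i)
       - (if i = l j then 1 else 0)
       + (if i = Suc (l j) then if j \<noteq> c then real (A (l j)) / real (A (Suc (l j))) else 0 else 0))"
    unfolding weight_def
    by (rule sum.cong) (auto simp: card_live_step [OF assms] diff_divide_distrib add_divide_distrib)
  also have "\<dots> = weight h d j - (\<Sum>i = 1..<k. if i = l j then 1 else 0)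
      + (\<Sum>i = 1..<k. if i = Suc (l j)
           then if j \<noteq> c then real (A (l j)) / real (A (Suc (l j))) else 0 else 0)"
    by (simp only: weight_def sum.distrib sum_subtractf)
  finally show ?thesis
    using level_bound [OF assms] by (simp add: sum.delta)
qed

lemma empties_step:
  "real (card (empties (h @ [(\<Union>j<m. K j, c)]))) / real (A 0) =
     real (card (empties h)) / real (A 0) - (\<Sum>j<m. if l j = 0 then 1 else 0)"
proof -
  define J where "J = {j. j < m \<and> l j = 0}"
  have eq: "empties (h @ [(\<Union>j<m. K j, c)]) = empties h - (\<Union>j\<in>J. K j)"
    using chunk_elem by (auto simp: empties_def J_def split: if_splits)
  have sub: "(\<Union>j\<in>J. K j) \<subseteq> empties h"
    using chunk_subset by (fastforce simp: J_def)
  have "card (\<Union>j\<in>J. K j) = (\<Sum>j\<in>J. card (K j))"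
    using finite_chunk chunk_unique by (intro card_UN_disjoint) (auto simp: J_def)
  also have "\<dots> = (\<Sum>j\<in>J. A 0)"
    using card_chunk by (intro sum.cong) (auto simp: J_def)
  finally have card: "card (\<Union>j\<in>J. K j) = card J * A 0"
    by simp
  have le: "card J * A 0 \<le> card (empties h)"
    using card_mono [OF finite_empties sub] card by simp
  have "card (empties (h @ [(\<Union>j<m. K j, c)])) = card (empties h) - card J * A 0"
    using sub card by (simp add: eq card_Diff_subset finite_subset [OF sub])
  then have "real (card (empties (h @ [(\<Union>j<m. K j, c)]))) / real (A 0) =
      real (card (empties h)) / real (A 0) - real (card J)"
    using le by (simp add: of_nat_diff diff_divide_distrib)
  moreover have "(\<Sum>j<m. if l j = 0 then 1 else 0) = real (card J)"
    by (simp add: sum.If_cases J_def lessThan_def Collect_conj_eq)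
  ultimately show ?thesis
    by simp
qed

text \<open>With empty hyperedges counted, every color pays 1. Under \<open>no_win\<close> each of
  the \<open>m - 1\<close> colors other than \<open>c\<close> gets back at least
  \<open>1 + 1 / (m - 1)\<close>, which together makes up for the loss at \<open>c\<close>.\<close>

lemma rich_step:
  assumes "rich h d" and "c < m" and no_win: "\<And>j. j < m \<Longrightarrow> j \<noteq> c \<Longrightarrow> Suc (l j) < k"
  shows "rich (h @ [(\<Union>j<m. K j, c)]) (redesignate K d)"
proof -
  let ?h = "h @ [(\<Union>j<m. K j, c)]" and ?d = "redesignate K d"
  have bound: "card (live ?h ?d j i) < A i + A (i - 1)" if "j < m" "1 \<le> i" "i < k" for j i
  proof (cases "i = Suc (l j)")
    \<comment> \<open>Only the level just above the selected one can grow, and maximality of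
      \<open>l j\<close> left it below \<open>A i\<close>.\<close>
    case True
    have "real (card (live ?h ?d j i)) \<le> real (card (live h d j i) + A (l j))"
      using card_live_step [OF that, of c] True by simp
    then have "card (live ?h ?d j i) \<le> card (live h d j i) + A (l j)"
      by (simp only: of_nat_le_iff)
    with above_top [OF that(1), of i] True that show ?thesis
      by simp
  next
    case False
    then have "live ?h ?d j i \<subseteq> live h d j i"
      by (auto simp: live_step [OF that(1,2)])
    then have "card (live ?h ?d j i) \<le> card (live h d j i)"
      by (intro card_mono) auto
    with assms(1) that show ?thesis
      by (auto simp: rich_def intro: le_less_trans)
  qed
  have "0 = (\<Sum>j<m. (if j = c then - 1 else 1 / (real m - 1)))"
  proof -
    have "(\<Sum>j<m. (if j = c then - 1 else 1 / (real m - 1))) =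
        - 1 + (\<Sum>j\<in>{..<m} - {c}. 1 / (real m - 1))"
      using assms(2) by (simp add: sum.remove [of _ c])
    also have "\<dots> = 0"
      using assms(2) m by (simp add: of_nat_diff)
    finally show ?thesis
      by simp
  qed
  also have "\<dots> \<le> (\<Sum>j<m. weight ?h ?d j - weight h d j - (if l j = 0 then 1 else 0))"
  proof (rule sum_mono)
    fix j assume "j \<in> {..<m}"
    then have j: "j < m" by simp
    show "(if j = c then - 1 else 1 / (real m - 1)) \<le>
        weight ?h ?d j - weight h d j - (if l j = 0 then 1 else 0)"
      using weight_step [OF j, of c] no_win [OF j] A_ratio [of "l j"] by (auto split: if_splits)
  qed
  finally have "real n / real (A 0) \<le> (\<Sum>j<m. weight ?h ?d j) + real (card (empties ?h)) / real (A 0)"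
    using assms(1) empties_step [of c] by (simp add: rich_def sum_subtractf)
  with bound show ?thesis
    by (simp add: rich_def)
qed

end

section \<open>Playing the strategy to the end\<close>

lemma safe_step:
  assumes "safe h" and "\<not> game_over k n h" and n: "n = A 0 * (m * (3 * k - 2))"
  shows "\<exists>S. legal_presentation k n h S \<and> (\<forall>c<m. safe (h @ [(S, c)]))"
proof (cases "won h")
  case True
  then obtain w where w: "w < n" "level h w = k" "card (edge_colors h w) < m"
    by (auto simp: won_def)
  \<comment> \<open>The outcome is decided but the game must be completed: a hyperedge that is not
    full gets a vertex of its own, which leaves the full \<open>w\<close> untouched.\<close>
  from assms(1,2) obtain e where e: "e < n" "level h e < k"
    by (auto simp: game_over_def safe_def nat_less_le)
  have "w \<noteq> e"
    using w e by auto
  then have "won (h @ [({e}, c)])" for c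
    using w by (auto simp: won_def intro!: exI [of _ w])
  with e assms(1) have "legal_presentation k n h {e} \<and> (\<forall>c<m. safe (h @ [({e}, c)]))"
    by (auto simp: legal_presentation_def safe_def)
  then show ?thesis
    by blast
next
  case False
  with assms(1) obtain d where rich: "rich h d"
    by (auto simp: safe_def)
  from ex_top_chunks [OF enough_empties [OF rich n]] obtain l K where top: "top_chunks h d l K"
    by blast
  let ?S = "\<Union>j<m. K j"
  have S: "e < n \<and> level h e < k" if "e \<in> ?S" for e
    using that chunk_elem [OF top] level_bound [OF top] by fastforce
  have nonempty: "K j \<noteq> {}" if "j < m" for j
    using card_chunk [OF top that] by (metis card.empty chunk_pos less_numeral_extra(3))
  have "0 < m"
    using m by simp
  with nonempty S have legal: "legal_presentation k n h ?S"
    by (auto simp: legal_presentation_def)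
  have "safe (h @ [(?S, c)])" if c: "c < m" for c
  proof -
    have bounds: "\<forall>e<n. level (h @ [(?S, c)]) e \<le> k \<and> edge_colors (h @ [(?S, c)]) e \<subseteq> {..<m}"
      using assms(1) S c by (auto simp: safe_def Suc_le_eq)
    have "won (h @ [(?S, c)]) \<or> (\<exists>d. rich (h @ [(?S, c)]) d)"
    proof (cases "\<exists>j<m. j \<noteq> c \<and> Suc (l j) \<ge> k")
      \<comment> \<open>A surviving chunk that rises from level \<open>k - 1\<close> consists of
        full hyperedges without color \<open>j\<close>, which decides the game.\<close>
      case True
      then obtain j e where j: "j < m" "j \<noteq> c" "Suc (l j) \<ge> k" and e: "e \<in> K j"
        using nonempty by blast
      note ce = chunk_elem [OF top j(1) e]
      have "e \<in> ?S"
        using j e by auto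
      then have "level (h @ [(?S, c)]) e = k" "j \<notin> edge_colors (h @ [(?S, c)]) e"
        using ce j level_bound [OF top j(1)] by auto
      moreover have "edge_colors (h @ [(?S, c)]) e \<subset> {..<m}"
        using bounds ce j(1) \<open>j \<notin> edge_colors (h @ [(?S, c)]) e\<close> by blast
      then have "card (edge_colors (h @ [(?S, c)]) e) < m"
        by (metis psubset_card_mono finite_lessThan card_lessThan)
      ultimately show ?thesis
        using ce unfolding won_def by blast
    next
      case False
      then have "rich (h @ [(?S, c)]) (redesignate K d)"
        by (intro rich_step [OF top rich c]) (auto simp: not_le)
      then show ?thesis
        by blast
    qed
    with bounds show ?thesis
      unfolding safe_def by blast
  qed
  with legal show ?thesis
    by blast
qed

text \<open>If no win were decided, \<open>rich\<close> would leave empty hyperedges, contradicting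
  the end of the game because \<open>k \<ge> 1\<close>.\<close>

lemma safe_over:
  assumes "safe h" and "game_over k n h" and n: "n = A 0 * (m * (3 * k - 2))"
  shows "presenter_wins_at m n h"
proof -
  have "won h \<or> (\<exists>e. e \<in> empties h)"
  proof (cases "won h")
    case False
    with assms(1) obtain d where "rich h d"
      by (auto simp: safe_def)
    moreover have "0 < m * A 0"
      using m by simp
    ultimately have "0 < card (empties h)"
      using enough_empties [OF _ n] by (meson less_le_trans)
    then show ?thesis
      by (auto simp: card_gt_0_iff)
  qed simp
  then show ?thesis
    using assms(2) k by (auto simp: won_def empties_def game_over_def presenter_wins_at_def)
qed

lemma safe_Nil: "safe []"
proof -
  have "live [] d j i = {}" if "1 \<le> i" for d j i
    using that by (auto simp: live_def)
  then have "rich [] (\<lambda>_. 0)"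
    by (auto simp: rich_def weight_def empties_def)
  then show ?thesis
    by (auto simp: safe_def)
qed

lemma presenter_wins:
  assumes "n = A 0 * (m * (3 * k - 2))"
  shows "\<exists>\<sigma>. presenter_winning_strategy k m n \<sigma>"
  using safe_Nil safe_over safe_step assms
  by (intro presenter_winning_strategy_of_invariant [of safe]) auto

end

section \<open>The numerical bound\<close>

theorem corollary3p11:
  fixes m k :: nat
  assumes "m \<ge> 2" and "k \<ge> 1"
  shows "ereal_of_enat (p_OL k m)
           \<le> ereal (real m ^ 3 * (real k + 1) * (real m / (real m - 1)) ^ k)"
proof -
  define n where "n = chunk m (k - 1) * (m * (3 * k - 2))"
  define q where "q = real m / (real m - 1)"
  interpret chunk_strategy k m n
    using assms by unfold_locales
  have q: "1 \<le> q"
    using assms by (simp add: q_def)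
  have "\<exists>\<sigma>. presenter_winning_strategy k m n \<sigma>"
    by (rule presenter_wins) (simp add: n_def)
  moreover have "n \<ge> 1"
    using assms by (simp add: n_def Suc_le_eq)
  ultimately have "p_OL k m \<le> enat n"
    unfolding p_OL_def by (intro Inf_lower) blast
  then have "ereal_of_enat (p_OL k m) \<le> ereal_of_enat (enat n)"
    by (simp only: ereal_of_enat_le_iff)
  also have "\<dots> = ereal (real n)"
    by simp
  also have "real n \<le> real m ^ 3 * (real k + 1) * q ^ k"
  proof -
    have "real n = real (chunk m (k - 1)) * (real m * (3 * real k - 2))"
      using assms by (simp add: n_def of_nat_diff)
    also have "\<dots> \<le> ((real m - 1) * q ^ k) * (real m * (3 * real k - 2))"
    proof (rule mult_right_mono)
      have "real (chunk m (k - 1)) \<le> (real m - 1) * q ^ (k - 1)"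
        unfolding q_def by (rule chunk_upper [OF assms(1)])
      also have "\<dots> \<le> (real m - 1) * q ^ k"
        using q assms by (intro mult_left_mono power_increasing) auto
      finally show "real (chunk m (k - 1)) \<le> (real m - 1) * q ^ k" .
    qed (use assms in auto)
    also have "\<dots> = q ^ k * (real m * ((real m - 1) * (3 * real k - 2)))"
      by (simp add: mult_ac)
    also have "\<dots> \<le> q ^ k * (real m * (real m ^ 2 * (real k + 1)))"
    proof (intro mult_left_mono)
      \<comment> \<open>The square of \<open>m - 2\<close> being nonnegative lets \<open>m^2\<close>
        absorb both the factor \<open>m - 1\<close> of the chunk size and a factor 4, so that
        \<open>3 * k - 2\<close> may be relaxed to \<open>4 * (k + 1)\<close>.\<close>
      have "4 * (real m - 1) \<le> real m ^ 2"
        using zero_le_power2 [of "real m - 2"] by (simp add: power2_eq_square algebra_simps)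
      then have "4 * (real m - 1) * (real k + 1) \<le> real m ^ 2 * (real k + 1)"
        by (rule mult_right_mono) simp
      then have "(real m - 1) * (4 * (real k + 1)) \<le> real m ^ 2 * (real k + 1)"
        by (simp only: mult_ac)
      moreover have "(real m - 1) * (3 * real k - 2) \<le> (real m - 1) * (4 * (real k + 1))"
        using assms by (intro mult_left_mono) auto
      ultimately show "(real m - 1) * (3 * real k - 2) \<le> real m ^ 2 * (real k + 1)"
        by linarith
    qed (use q in auto)
    finally show ?thesis
      by (simp add: power2_eq_square power3_eq_cube mult_ac)
  qed
  finally show ?thesis
    by (simp add: q_def)
qed

end
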